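(* Let $\{x_k\}$ be generated by the simplified stochastic SQP algorithm described in the context for the problem $\min_{x\in C} r(x)=\mathbb{E}[R(x,\xi)]$, with stochastic steps $\bar d_k=x_{k+1}-x_k$, stochastic subgradient estimates $\bar g_k$, vectors $\bar v_k\in\bar\partial i_C(x_k+\bar d_k)$ from the optimality conditions of the subproblem, and variance bounds $M_k$. If $\sum_{k=0}^{\infty} M_k<\infty$, then $$\lim_{k\to\infty}\mathbb{E}\left[\sum_{i=0}^{k-1}\|x_{i+1}-x_i\|^2\right]<\infty .$$ It follows that $\lim_{k\to\infty}\mathbb{E}[\|\bar d_k\|]=0$ and $\lim_{k\to\infty}\mathbb{E}[\|\bar g_k+\bar v_k\|]=0$.
   Context: $\|\cdot\|$ is the Euclidean norm, $\bar\partial$ the Clarke subdifferential, $i_C$ the indicator function of $C$ ($0$ on $C$, $+\infty$ outside). Standing assumptions: (i) $r:\mathbb{R}^n\to\mathbb{R}$, $r(x)=\mathbb{E}[R(x,\xi)]$ with $\xi$ a random vector, is Lipschitz continuous and upper-$\mathcal{C}^2$ (i.e. locally $r(x)=\min_{t\in T}p(t,x)$ with $T$ compact and $p$ and its first and second partial derivatives in $x$ continuous in $(t,x)$); $\rho>0$ is a constant such that $r(x)-r(\bar x)-\langle g,x-\bar x\rangle\le\frac{\rho}{2}\|x-\bar x\|^2$ for all $x,\bar x\in C$ and $g\in\bar\partial r(\bar x)$. (ii) $C\subset\mathbb{R}^n$ is (nonempty) convex and compact. Algorithm: fix $\eta_\alpha>1$, $x_0\in C$, $\alpha_0\in[\rho,\eta_\alpha\rho]$.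 For $k=0,1,2,\dots$: draw a set $S_k$ of i.i.d. samples of $\xi$, compute a stochastic estimate $\bar g_k$ of a subgradient $g_k\in\bar\partial r(x_k)$; let $\bar d_k$ be the solution of $\min_{d:\,x_k+d\in C}\ \bar g_k^Td+\frac12\alpha_k\|d\|^2$; set $x_{k+1}=x_k+\bar d_k$; choose $\alpha_{k+1}\in[\alpha_k,\eta_\alpha\rho]$, the choice of $\alpha_k$ being independent of the stochastic estimates. The optimality conditions of the subproblem are $\bar g_k+\alpha_k\bar d_k+\bar v_k=0$, $x_k+\bar d_k\in C$, $\bar v_k\in\bar\partial i_C(x_k+\bar d_k)$. Noise assumption: for all $k$, $\mathbb{E}_k[\bar g_k]=g_k$ and $\mathbb{E}_k[\|\bar g_k-g_k\|^2]\le M_k$, where $M_k>0$ is a sequence independent of the stochastic solutions (deterministic), and $\mathbb{E}_k$ is the expectation conditioned on the iterate $x_k$ (i.e. on the samples that generated $x_k$). $\mathbb{E}$ is total expectation. *)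

theory Defs
  imports "HOL-Probability.Probability"
begin

section \<open>Clarke subdifferential\<close>

text \<open>
  The subdifferential is defined for extended-real-valued functions through the Clarke normal cone
  of the epigraph, so that one notion covers both finite functions and indicator functions. The
  tangent cone below is the sequential description of the Clarke (regular) tangent cone; it is used
  only at points of the set.
\<close>

definition clarke_tangent_cone :: "'a::real_normed_vector set \<Rightarrow> 'a \<Rightarrow> 'a set" where
  "clarke_tangent_cone S x =
     {v. \<forall>X t. (\<forall>n. X n \<in> S) \<and> X \<longlonglongrightarrow> x \<and> (\<forall>n. 0 < (t n :: real)) \<and> t \<longlonglongrightarrow> 0 \<longrightarrow>
           (\<exists>V. V \<longlonglongrightarrow> v \<and> (\<forall>n::nat. X n + t n *\<^sub>R V n \<in> S))}"

definition clarke_normal_cone :: "'a::real_inner set \<Rightarrow> 'a \<Rightarrow> 'a set" where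
  "clarke_normal_cone S x = {z. \<forall>v \<in> clarke_tangent_cone S x. z \<bullet> v \<le> 0}"

definition clarke_subdifferential :: "('a::euclidean_space \<Rightarrow> ereal) \<Rightarrow> 'a \<Rightarrow> 'a set" where
  "clarke_subdifferential f x =
     {g. \<bar>f x\<bar> \<noteq> \<infinity> \<and>
         (g, -1) \<in> clarke_normal_cone {(y, c :: real). f y \<le> ereal c} (x, real_of_ereal (f x))}"

definition indicator_fun :: "'a set \<Rightarrow> 'a \<Rightarrow> ereal" where
  "indicator_fun C x = (if x \<in> C then 0 else \<infinity>)"

section \<open>Upper-C2 functions\<close>

text \<open>
  HOL cannot quantify over types inside a formula, so the type of the index \<open>t\<close> is a
  parameter. The functions \<open>p1 i\<close> and \<open>p2 i j\<close> are the first and second partial derivatives of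
  \<open>p t\<close> in the coordinate directions \<open>i\<close> and \<open>i, j\<close>.
\<close>

definition upper_C2 :: "'t::topological_space itself \<Rightarrow> ('a::euclidean_space \<Rightarrow> real) \<Rightarrow> bool" where
  "upper_C2 _ r \<longleftrightarrow>
     (\<forall>xbar. \<exists>V (T :: 't set) p p1 p2.
        open V \<and> xbar \<in> V \<and> compact T \<and>
        (\<forall>x\<in>V. (\<exists>t\<in>T. r x = p t x) \<and> (\<forall>t\<in>T. r x \<le> p t x)) \<and>
        continuous_on (T \<times> V) (\<lambda>(t, x). p t x) \<and>
        (\<forall>i\<in>Basis.
           (\<forall>t\<in>T. \<forall>x\<in>V. ((\<lambda>s. p t (x + s *\<^sub>R i)) has_real_derivative p1 i t x) (at 0)) \<and>
           continuous_on (T \<times> V) (\<lambda>(t, x). p1 i t x) \<and>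
           (\<forall>j\<in>Basis.
              (\<forall>t\<in>T. \<forall>x\<in>V. ((\<lambda>s. p1 i t (x + s *\<^sub>R j)) has_real_derivative p2 i j t x) (at 0)) \<and>
              continuous_on (T \<times> V) (\<lambda>(t, x). p2 i j t x))))"

section \<open>Conditional expectation given a random vector\<close>

definition sigma_of :: "'w measure \<Rightarrow> ('w \<Rightarrow> 'a::topological_space) \<Rightarrow> 'w measure" where
  "sigma_of P X = vimage_algebra (space P) X borel"

text \<open>The library's conditional expectation is real-valued; vectors are treated coordinatewise.\<close>

definition vec_cond_exp ::
  "'w measure \<Rightarrow> 'w measure \<Rightarrow> ('w \<Rightarrow> 'a::euclidean_space) \<Rightarrow> 'w \<Rightarrow> 'a" where
  "vec_cond_exp P F f \<omega> = (\<Sum>b\<in>Basis. real_cond_exp P F (\<lambda>\<omega>. f \<omega> \<bullet> b) \<omega> *\<^sub>R b)"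

end

theory Submission
  imports Defs
begin

text \<open>
  The proximal step is the projection of \<open>x\<^sub>k - gbar\<^sub>k / \<alpha>\<^sub>k\<close> onto \<open>C\<close>; in particular the iterates are
  measurable, and the variational inequality of the projection gives
  \<open>gbar\<^sub>k \<bullet> d\<^sub>k \<le> - \<alpha>\<^sub>k \<parallel>d\<^sub>k\<parallel>\<^sup>2\<close>. Inserted into the upper quadratic bound on \<open>r\<close> with \<open>\<alpha>\<^sub>k \<ge> \<rho>\<close>, and with
  Young's inequality for \<open>(g\<^sub>k - gbar\<^sub>k) \<bullet> d\<^sub>k\<close>, this yields the pathwise descent estimate
  \<open>\<rho>/4 \<parallel>d\<^sub>k\<parallel>\<^sup>2 \<le> r(x\<^sub>k) - r(x\<^sub>k\<^sub>+\<^sub>1) + \<parallel>gbar\<^sub>k - g\<^sub>k\<parallel>\<^sup>2 / \<rho>\<close>. Taking expectations and telescoping, with \<open>r\<close>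
  bounded on \<open>C\<close>, bounds the sum of the second moments of the steps. The remaining limits follow from
  \<open>(E\<parallel>d\<^sub>k\<parallel>)\<^sup>2 \<le> E\<parallel>d\<^sub>k\<parallel>\<^sup>2\<close>, \<open>gbar\<^sub>k + vbar\<^sub>k = - \<alpha>\<^sub>k d\<^sub>k\<close> and the boundedness of \<open>\<alpha>\<^sub>k\<close>.
\<close>

text \<open>Completing the square turns the subproblem objective into a positive multiple of the
  squared distance from \<open>x + d\<close> to \<open>x - (1 / a) *\<^sub>R g\<close>, up to a
  constant. A minimiser is therefore a nearest point of \<open>C\<close>, and convexity makes that
  point unique.\<close>

lemma proximal_step_eq_closest_point:
  fixes x g d :: "'a::euclidean_space"
  assumes C: "convex C" "closed C" and a: "a > 0"
    and d: "is_arg_min (\<lambda>d. g \<bullet> d + 1 / 2 * a * (norm d)\<^sup>2) (\<lambda>d. x + d \<in> C) d"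
  shows "x + d = closest_point C (x - (1 / a) *\<^sub>R g)"
proof (rule closest_point_unique[OF C])
  let ?y = "x - (1 / a) *\<^sub>R g"
  show "x + d \<in> C"
    using d by (simp add: is_arg_min_def)
  \<comment> \<open>The last summand does not depend on \<open>e\<close>, so comparing objective
    values amounts to comparing these norms.\<close>
  have square: "(norm (e + (1 / a) *\<^sub>R g))\<^sup>2
      = 2 / a * (g \<bullet> e + 1 / 2 * a * (norm e)\<^sup>2) + (norm g)\<^sup>2 / a\<^sup>2" for e
    unfolding dot_norm[of e "(1 / a) *\<^sub>R g"] power2_norm_eq_inner using a
    by (simp add: inner_add_left inner_add_right inner_commute field_simps power2_eq_square)
  show "\<forall>z\<in>C. dist ?y (x + d) \<le> dist ?y z"
  proof
    fix z assume "z \<in> C"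
    \<comment> \<open>The competitor \<open>z - x\<close> is feasible, since adding it to
      \<open>x\<close> gives \<open>z\<close>.\<close>
    then have "g \<bullet> d + 1 / 2 * a * (norm d)\<^sup>2 \<le> g \<bullet> (z - x) + 1 / 2 * a * (norm (z - x))\<^sup>2"
      using d unfolding is_arg_min_def by (metis add_diff_cancel_left' diff_add_cancel add.commute not_le)
    then have "(norm (d + (1 / a) *\<^sub>R g))\<^sup>2 \<le> (norm (z - x + (1 / a) *\<^sub>R g))\<^sup>2"
      unfolding square using a by (intro add_right_mono mult_left_mono) auto
    then have "norm (d + (1 / a) *\<^sub>R g) \<le> norm (z - x + (1 / a) *\<^sub>R g)"
      by (rule power2_le_imp_le) simp
    moreover have "dist ?y w = norm (w - x + (1 / a) *\<^sub>R g)" for w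
      by (subst dist_commute) (simp add: dist_norm algebra_simps)
    ultimately show "dist ?y (x + d) \<le> dist ?y z"
      by simp
  qed
qed

text \<open>The obtuse-angle inequality of the projection is tested at the point \<open>x\<close> of
  \<open>C\<close>. Comparing the objective at \<open>d\<close> and at \<open>0\<close> would give
  only half of this decrease.\<close>

lemma proximal_step_inner_le:
  fixes x g d :: "'a::euclidean_space"
  assumes C: "convex C" "closed C" and a: "a > 0" and x: "x \<in> C"
    and d: "is_arg_min (\<lambda>d. g \<bullet> d + 1 / 2 * a * (norm d)\<^sup>2) (\<lambda>d. x + d \<in> C) d"
  shows "g \<bullet> d \<le> - (a * (norm d)\<^sup>2)"
proof -
  have "(x - (1 / a) *\<^sub>R g - (x + d)) \<bullet> (x - (x + d)) \<le> 0"
    using closest_point_dot[OF C x, of "x - (1 / a) *\<^sub>R g"]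
    unfolding proximal_step_eq_closest_point[OF C a d, symmetric] .
  then have "d \<bullet> d + g \<bullet> d / a \<le> 0"
    by (simp add: inner_diff_left)
  with a show ?thesis
    by (simp add: field_simps power2_norm_eq_inner)
qed

text \<open>Expand the nonnegative square of \<open>(2 / c) *\<^sub>R u - v\<close> and scale it by
  \<open>c / 4\<close>.\<close>

lemma inner_le_Young:
  fixes u v :: "'a::real_inner"
  assumes "c > 0"
  shows "u \<bullet> v \<le> (norm u)\<^sup>2 / c + c / 4 * (norm v)\<^sup>2"
proof -
  have "0 \<le> (norm ((2 / c) *\<^sub>R u - v))\<^sup>2 * (c / 4)"
    using assms by simp
  also have "\<dots> = (norm u)\<^sup>2 / c + c / 4 * (norm v)\<^sup>2 - u \<bullet> v"
    unfolding power2_norm_eq_inner using assms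
    by (simp add: inner_diff_left inner_diff_right inner_commute field_simps power2_eq_square)
  finally show ?thesis by simp
qed

lemma subalgebra_sigma_of:
  assumes "X \<in> borel_measurable P"
  shows "subalgebra P (sigma_of P X)"
  unfolding subalgebra_def sigma_of_def
  using assms by (auto simp: sets_vimage_algebra2 measurable_sets)

text \<open>Tower property. Staying with nonnegative integrals avoids assuming that \<open>f\<close>
  is integrable, so finiteness of the noise variance can be deduced from it.\<close>

lemma (in prob_space) nn_integral_le_of_nn_cond_exp_le:
  assumes "subalgebra M F" and [measurable]: "f \<in> borel_measurable M"
    and le: "AE \<omega> in M. nn_cond_exp M F f \<omega> \<le> c"
  shows "(\<integral>\<^sup>+\<omega>. f \<omega> \<partial>M) \<le> c"
proof -
  interpret finite_measure_subalgebra M F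
    by unfold_locales fact
  have "(\<integral>\<^sup>+\<omega>. f \<omega> \<partial>M) = (\<integral>\<^sup>+\<omega>. nn_cond_exp M F f \<omega> \<partial>M)"
    using nn_cond_exp_intg[of "\<lambda>_. 1" f] by simp
  also have "\<dots> \<le> (\<integral>\<^sup>+\<omega>. c \<partial>M)"
    using le by (rule nn_integral_mono_AE)
  finally show ?thesis
    by (simp add: emeasure_space_1)
qed

text \<open>The difference of the two sides is the variance of \<open>X\<close>.\<close>

lemma (in prob_space) square_expectation_le:
  fixes X :: "'a \<Rightarrow> real"
  assumes "integrable M X" "integrable M (\<lambda>\<omega>. (X \<omega>)\<^sup>2)"
  shows "(expectation X)\<^sup>2 \<le> expectation (\<lambda>\<omega>. (X \<omega>)\<^sup>2)"
  using variance_eq[OF assms] variance_positive[of X] by simp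

theorem theorem3p9:
  fixes P :: "'w measure"
    and \<xi> :: "'w \<Rightarrow> 'b::euclidean_space"
    and R :: "'a::euclidean_space \<Rightarrow> 'b \<Rightarrow> real"
    and r :: "'a \<Rightarrow> real"
    and C :: "'a set"
    and \<rho> \<eta> \<alpha>0 :: real
    and x0 :: 'a
    and \<alpha> M :: "nat \<Rightarrow> real"
    and N :: "nat \<Rightarrow> nat"
    and S :: "nat \<Rightarrow> nat \<Rightarrow> 'w \<Rightarrow> 'b"
    and G :: "nat \<Rightarrow> 'a \<Rightarrow> (nat \<Rightarrow> 'b) \<Rightarrow> 'a"
    and x g gbar dbar vbar :: "nat \<Rightarrow> 'w \<Rightarrow> 'a"
  assumes prob: "prob_space P"
    (* the objective *)
    and xi: "\<xi> \<in> borel_measurable P"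
    and R_int: "\<And>y. integrable P (\<lambda>\<omega>. R y (\<xi> \<omega>))"
    and r_def: "\<And>y. r y = (\<integral>\<omega>. R y (\<xi> \<omega>) \<partial>P)"
    and r_lipschitz: "\<exists>L. L-lipschitz_on UNIV r"
    and r_upper_C2: "upper_C2 TYPE('t::topological_space) r"
    and rho_pos: "\<rho> > 0"
    and rho: "\<And>y ybar h. y \<in> C \<Longrightarrow> ybar \<in> C \<Longrightarrow> h \<in> clarke_subdifferential (\<lambda>z. ereal (r z)) ybar \<Longrightarrow>
                r y - r ybar - h \<bullet> (y - ybar) \<le> \<rho> / 2 * (norm (y - ybar))\<^sup>2"
    (* the constraint set *)
    and C: "C \<noteq> {}" "convex C" "compact C"
    (* the algorithm *)
    and eta: "\<eta> > 1"
    and x0: "x0 \<in> C" "\<And>\<omega>. \<omega> \<in> space P \<Longrightarrow> x 0 \<omega> = x0"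
    and alpha0: "\<alpha>0 \<in> {\<rho>..\<eta> * \<rho>}" "\<alpha> 0 = \<alpha>0"
    and alpha_Suc: "\<And>k. \<alpha> (Suc k) \<in> {\<alpha> k..\<eta> * \<rho>}"
    and samples_indep: "\<And>k. prob_space.indep_vars P (\<lambda>_. borel) (S k) {..<N k}"
    and samples_distr: "\<And>k i. i < N k \<Longrightarrow> distr P borel (S k i) = distr P borel \<xi>"
    and G_meas: "\<And>k. (\<lambda>(y, s). G k y s) \<in> borel_measurable (borel \<Otimes>\<^sub>M Pi\<^sub>M {..<N k} (\<lambda>_. borel))"
    and gbar: "\<And>k \<omega>. \<omega> \<in> space P \<Longrightarrow> gbar k \<omega> = G k (x k \<omega>) (\<lambda>i\<in>{..<N k}. S k i \<omega>)"
    and g_subgrad: "\<And>k \<omega>. \<omega> \<in> space P \<Longrightarrow> g k \<omega> \<in> clarke_subdifferential (\<lambda>z. ereal (r z)) (x k \<omega>)"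
    and dbar: "\<And>k \<omega>. \<omega> \<in> space P \<Longrightarrow>
                 is_arg_min (\<lambda>d. gbar k \<omega> \<bullet> d + 1 / 2 * \<alpha> k * (norm d)\<^sup>2)
                   (\<lambda>d. x k \<omega> + d \<in> C) (dbar k \<omega>)"
    and x_Suc: "\<And>k \<omega>. \<omega> \<in> space P \<Longrightarrow> x (Suc k) \<omega> = x k \<omega> + dbar k \<omega>"
    and optimality: "\<And>k \<omega>. \<omega> \<in> space P \<Longrightarrow> gbar k \<omega> + \<alpha> k *\<^sub>R dbar k \<omega> + vbar k \<omega> = 0"
    and vbar: "\<And>k \<omega>. \<omega> \<in> space P \<Longrightarrow>
                 vbar k \<omega> \<in> clarke_subdifferential (indicator_fun C) (x k \<omega> + dbar k \<omega>)"
    (* the noise, with expectations conditioned on the iterate x k *)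
    and g_meas: "\<And>k. g k \<in> borel_measurable P"
    and gbar_int: "\<And>k. integrable P (gbar k)"
    and unbiased: "\<And>k. AE \<omega> in P. vec_cond_exp P (sigma_of P (x k)) (gbar k) \<omega> = g k \<omega>"
    and M_pos: "\<And>k. M k > 0"
    and variance: "\<And>k. AE \<omega> in P.
                 nn_cond_exp P (sigma_of P (x k)) (\<lambda>\<omega>. ennreal ((norm (gbar k \<omega> - g k \<omega>))\<^sup>2)) \<omega>
                   \<le> ennreal (M k)"
    and M_summable: "summable M"
  shows "(\<forall>k. integrable P (\<lambda>\<omega>. \<Sum>i<k. (norm (x (Suc i) \<omega> - x i \<omega>))\<^sup>2)) \<and>
         convergent (\<lambda>k. \<integral>\<omega>. (\<Sum>i<k. (norm (x (Suc i) \<omega> - x i \<omega>))\<^sup>2) \<partial>P) \<and>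
         (\<forall>k. integrable P (\<lambda>\<omega>. norm (dbar k \<omega>))) \<and>
         (\<lambda>k. \<integral>\<omega>. norm (dbar k \<omega>) \<partial>P) \<longlonglongrightarrow> 0 \<and>
         (\<forall>k. integrable P (\<lambda>\<omega>. norm (gbar k \<omega> + vbar k \<omega>))) \<and>
         (\<lambda>k. \<integral>\<omega>. norm (gbar k \<omega> + vbar k \<omega>) \<partial>P) \<longlonglongrightarrow> 0"
proof -
  interpret prob_space P by (fact prob)
  define e where "e k = expectation (\<lambda>\<omega>. r (x k \<omega>))" for k
  define D where "D k = expectation (\<lambda>\<omega>. (norm (dbar k \<omega>))\<^sup>2)" for k
  have closed: "closed C"
    using C(3) by (rule compact_imp_closed)
  have alpha_le: "\<alpha> k \<le> \<eta> * \<rho>" for k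
    using alpha0 alpha_Suc by (cases k) auto
  have alpha_ge: "\<rho> \<le> \<alpha> k" for k
  proof (induction k)
    case 0
    then show ?case using alpha0 by simp
  next
    case (Suc k)
    then show ?case using alpha_Suc[of k] by simp
  qed
  have alpha_pos: "\<alpha> k > 0" for k
    using alpha_ge[of k] rho_pos by simp
  have x_in: "x k \<omega> \<in> C" if "\<omega> \<in> space P" for k \<omega>
    using that x0 x_Suc dbar by (cases k) (auto simp: is_arg_min_def)
  have [measurable]: "gbar k \<in> borel_measurable P" for k
    using gbar_int by (rule borel_measurable_integrable)
  note g_meas[measurable]
  \<comment> \<open>The steps are given only pointwise, as minimisers. Continuity of the projection
    onto a closed convex set is what carries measurability from \<open>x k\<close> and
    \<open>gbar k\<close> to \<open>x (Suc k)\<close>.\<close>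
  have [measurable]: "closest_point C \<in> borel_measurable borel"
    by (intro borel_measurable_continuous_onI continuous_on_closest_point C closed)
  have x_meas[measurable]: "x k \<in> borel_measurable P" for k
  proof (induction k)
    case 0
    have "(\<lambda>_. x0) \<in> borel_measurable P" by simp
    then show ?case using measurable_cong[of P "x 0" "\<lambda>_. x0" borel] x0 by auto
  next
    case (Suc k)
    note Suc[measurable]
    have "(\<lambda>\<omega>. closest_point C (x k \<omega> - (1 / \<alpha> k) *\<^sub>R gbar k \<omega>)) \<in> borel_measurable P"
      by measurable
    moreover have "x (Suc k) \<omega> = closest_point C (x k \<omega> - (1 / \<alpha> k) *\<^sub>R gbar k \<omega>)"
      if "\<omega> \<in> space P" for \<omega>
      unfolding x_Suc[OF that]
      by (rule proximal_step_eq_closest_point[OF C(2) closed alpha_pos dbar[OF that]])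
    ultimately show ?case
      using measurable_cong[of P "x (Suc k)"] by auto
  qed
  have dbar_eq: "dbar k \<omega> = x (Suc k) \<omega> - x k \<omega>" if "\<omega> \<in> space P" for k \<omega>
    using x_Suc[OF that] by simp
  have dbar_meas[measurable]: "dbar k \<in> borel_measurable P" for k
  proof -
    have "(\<lambda>\<omega>. x (Suc k) \<omega> - x k \<omega>) \<in> borel_measurable P" by measurable
    then show ?thesis
      using measurable_cong[of P "dbar k"] dbar_eq by auto
  qed

  obtain L where "L-lipschitz_on UNIV r"
    using r_lipschitz by blast
  then have r_cont: "continuous_on UNIV r"
    by (rule lipschitz_on_continuous_on)
  then have [measurable]: "r \<in> borel_measurable borel"
    by (rule borel_measurable_continuous_onI)
  \<comment> \<open>The bound \<open>B\<close> makes each \<open>r (x k \<omega>)\<close> integrable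
    and later controls both ends of the telescoped sum.\<close>
  have "compact (r ` C)"
    by (rule compact_continuous_image[OF continuous_on_subset[OF r_cont] C(3)]) simp
  then obtain B where B: "\<And>y. y \<in> C \<Longrightarrow> \<bar>r y\<bar> \<le> B"
    using compact_imp_bounded[of "r ` C"] by (auto simp: bounded_iff)
  have r_int: "integrable P (\<lambda>\<omega>. r (x k \<omega>))" for k
    by (rule integrable_const_bound[of _ B]) (auto intro!: AE_I2 B x_in)
  have e_abs: "\<bar>e k\<bar> \<le> B" for k
  proof -
    have "\<bar>e k\<bar> \<le> expectation (\<lambda>\<omega>. \<bar>r (x k \<omega>)\<bar>)"
      unfolding e_def by (rule integral_abs_bound)
    also have "\<dots> \<le> expectation (\<lambda>_. B)"
      using r_int by (intro integral_mono) (auto intro: B x_in)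
    finally show ?thesis by (simp add: prob_space)
  qed

  \<comment> \<open>Steps join two points of \<open>C\<close>, so a bound on its diameter gives
    integrability of their norms and squared norms.\<close>
  obtain K where K: "\<And>y z. y \<in> C \<Longrightarrow> z \<in> C \<Longrightarrow> dist y z \<le> K"
    using bounded_two_points[of C] compact_imp_bounded[OF C(3)] by auto
  have dbar_bound: "norm (dbar k \<omega>) \<le> K" if "\<omega> \<in> space P" for k \<omega>
    using K[OF x_in[OF that, of "Suc k"] x_in[OF that, of k]] by (simp add: dbar_eq[OF that] dist_norm)
  have dbar_int: "integrable P (\<lambda>\<omega>. norm (dbar k \<omega>))" for k
    by (rule integrable_const_bound[of _ K]) (auto intro!: AE_I2 dbar_bound)
  have dbar2_int: "integrable P (\<lambda>\<omega>. (norm (dbar k \<omega>))\<^sup>2)" for k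
    by (rule integrable_const_bound[of _ "K\<^sup>2"]) (auto intro!: AE_I2 power_mono dbar_bound)

  have noise_nn: "(\<integral>\<^sup>+\<omega>. ennreal ((norm (gbar k \<omega> - g k \<omega>))\<^sup>2) \<partial>P) \<le> ennreal (M k)" for k
    by (rule nn_integral_le_of_nn_cond_exp_le[OF subalgebra_sigma_of[OF x_meas] _ variance]) measurable
  have noise_int: "integrable P (\<lambda>\<omega>. (norm (gbar k \<omega> - g k \<omega>))\<^sup>2)" for k
    using noise_nn[of k] by (intro integrableI_bounded) (auto intro: le_less_trans)
  have noise_le: "expectation (\<lambda>\<omega>. (norm (gbar k \<omega> - g k \<omega>))\<^sup>2) \<le> M k" for k
    using noise_nn[of k] M_pos[of k] by (simp add: nn_integral_eq_integral[OF noise_int])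

  have descent: "\<rho> / 4 * (norm (dbar k \<omega>))\<^sup>2
      \<le> r (x k \<omega>) - r (x (Suc k) \<omega>) + (norm (gbar k \<omega> - g k \<omega>))\<^sup>2 / \<rho>"
    if w: "\<omega> \<in> space P" for k \<omega>
  proof -
    let ?d = "dbar k \<omega>"
    have "r (x (Suc k) \<omega>) - r (x k \<omega>) - g k \<omega> \<bullet> ?d \<le> \<rho> / 2 * (norm ?d)\<^sup>2"
      using rho[OF x_in[OF w, of "Suc k"] x_in[OF w] g_subgrad[OF w]] by (simp add: dbar_eq[OF w])
    moreover have "gbar k \<omega> \<bullet> ?d \<le> - (\<alpha> k * (norm ?d)\<^sup>2)"
      by (rule proximal_step_inner_le[OF C(2) closed alpha_pos x_in[OF w] dbar[OF w]])
    moreover have "\<rho> * (norm ?d)\<^sup>2 \<le> \<alpha> k * (norm ?d)\<^sup>2"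
      by (intro mult_right_mono alpha_ge) simp
    \<comment> \<open>Coefficients of the squared step length: the projection inequality supplies
      \<rho>, the quadratic bound on \<open>r\<close> consumes \<rho>/2 and Young's inequality
      \<rho>/4, which leaves \<rho>/4.\<close>
    moreover have "(g k \<omega> - gbar k \<omega>) \<bullet> ?d \<le> (norm (gbar k \<omega> - g k \<omega>))\<^sup>2 / \<rho> + \<rho> / 4 * (norm ?d)\<^sup>2"
      using inner_le_Young[OF rho_pos, of "g k \<omega> - gbar k \<omega>" ?d] by (simp add: norm_minus_commute)
    ultimately show ?thesis
      unfolding inner_diff_left by linarith
  qed
  have D_le: "D k \<le> 4 / \<rho> * (e k - e (Suc k) + M k / \<rho>)" for k
  proof -
    have "\<rho> / 4 * D k
        \<le> expectation (\<lambda>\<omega>. r (x k \<omega>) - r (x (Suc k) \<omega>) + (norm (gbar k \<omega> - g k \<omega>))\<^sup>2 / \<rho>)"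
      unfolding D_def integral_mult_right_zero[symmetric]
      using dbar2_int r_int noise_int by (intro integral_mono descent) auto
    also have "\<dots> = e k - e (Suc k) + expectation (\<lambda>\<omega>. (norm (gbar k \<omega> - g k \<omega>))\<^sup>2) / \<rho>"
      unfolding e_def using r_int noise_int by simp
    also have "\<dots> \<le> e k - e (Suc k) + M k / \<rho>"
      using noise_le rho_pos by (simp add: divide_right_mono)
    finally show ?thesis
      using rho_pos by (simp add: field_simps)
  qed
  have D_nonneg: "0 \<le> D k" for k
    unfolding D_def by simp
  have D_summable: "summable D"
  proof (rule bounded_imp_summable[OF D_nonneg])
    fix n
    have "(\<Sum>k\<le>n. D k) \<le> (\<Sum>k\<le>n. 4 / \<rho> * (e k - e (Suc k) + M k / \<rho>))"
      by (intro sum_mono D_le)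
    also have "\<dots> = 4 / \<rho> * (e 0 - e (Suc n) + (\<Sum>k\<le>n. M k) / \<rho>)"
      by (simp only: sum_distrib_left[symmetric] sum.distrib sum_telescope sum_divide_distrib)
    \<comment> \<open>\<open>e 0\<close> and \<open>- e (Suc n)\<close> contribute at most
      \<open>B\<close> each, so the bound is independent of \<open>n\<close>.\<close>
    also have "\<dots> \<le> 4 / \<rho> * (2 * B + suminf M / \<rho>)"
    proof -
      have "(\<Sum>k\<le>n. M k) \<le> suminf M"
        using M_summable M_pos by (intro sum_le_suminf) (auto intro: less_imp_le)
      then have "(\<Sum>k\<le>n. M k) / \<rho> \<le> suminf M / \<rho>"
        using rho_pos by (simp add: divide_right_mono)
      with e_abs[of 0] e_abs[of "Suc n"] show ?thesis
        using rho_pos by (intro mult_left_mono) auto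
    qed
    finally show "(\<Sum>k\<le>n. D k) \<le> 4 / \<rho> * (2 * B + suminf M / \<rho>)" .
  qed

  have step2_int: "integrable P (\<lambda>\<omega>. (norm (x (Suc k) \<omega> - x k \<omega>))\<^sup>2)" for k
    using dbar2_int[of k] by (simp add: dbar_eq cong: Bochner_Integration.integrable_cong)
  have step2_eq: "expectation (\<lambda>\<omega>. (norm (x (Suc k) \<omega> - x k \<omega>))\<^sup>2) = D k" for k
    unfolding D_def by (intro Bochner_Integration.integral_cong) (simp_all add: dbar_eq)
  \<comment> \<open>By linearity these expectations are the partial sums of
    \<open>D\<close>.\<close>
  have conv: "convergent (\<lambda>k. expectation (\<lambda>\<omega>. \<Sum>i<k. (norm (x (Suc i) \<omega> - x i \<omega>))\<^sup>2))"
    using D_summable by (simp add: step2_int step2_eq summable_iff_convergent)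

  have mean_lim: "(\<lambda>k. expectation (\<lambda>\<omega>. norm (dbar k \<omega>))) \<longlonglongrightarrow> 0"
  proof (rule tendsto_sandwich[OF _ _ tendsto_const])
    \<comment> \<open>The terms of the summable series \<open>D\<close> tend to zero, and
      \<open>sqrt\<close> is continuous at zero.\<close>
    show "(\<lambda>k. sqrt (D k)) \<longlonglongrightarrow> 0"
      using tendsto_real_sqrt[OF summable_LIMSEQ_zero[OF D_summable]] by simp
    show "\<forall>\<^sub>F k in sequentially. expectation (\<lambda>\<omega>. norm (dbar k \<omega>)) \<le> sqrt (D k)"
      unfolding D_def
      by (intro always_eventually allI real_le_rsqrt square_expectation_le dbar_int dbar2_int)
  qed simp
  have residual: "norm (gbar k \<omega> + vbar k \<omega>) = \<alpha> k * norm (dbar k \<omega>)" if "\<omega> \<in> space P" for k \<omega>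
  proof -
    have "gbar k \<omega> + vbar k \<omega> = - (\<alpha> k *\<^sub>R dbar k \<omega>)"
      using optimality[OF that, of k] by (metis add.commute add.left_commute add_eq_0_iff)
    then show ?thesis
      using alpha_pos[of k] by simp
  qed
  have residual_int: "integrable P (\<lambda>\<omega>. norm (gbar k \<omega> + vbar k \<omega>))" for k
    using dbar_int[of k] by (simp add: residual cong: Bochner_Integration.integrable_cong)
  have residual_eq: "expectation (\<lambda>\<omega>. norm (gbar k \<omega> + vbar k \<omega>))
      = \<alpha> k * expectation (\<lambda>\<omega>. norm (dbar k \<omega>))" for k
    by (simp add: residual cong: Bochner_Integration.integral_cong)
  have residual_lim: "(\<lambda>k. expectation (\<lambda>\<omega>. norm (gbar k \<omega> + vbar k \<omega>))) \<longlonglongrightarrow> 0"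
    unfolding residual_eq
  proof (rule tendsto_sandwich[OF _ _ tendsto_const])
    \<comment> \<open>Replacing \<open>\<alpha> k\<close> by its upper bound leaves a factor that
      does not vary with \<open>k\<close>.\<close>
    show "(\<lambda>k. \<eta> * \<rho> * expectation (\<lambda>\<omega>. norm (dbar k \<omega>))) \<longlonglongrightarrow> 0"
      using mean_lim by (rule tendsto_mult_right_zero)
    show "\<forall>\<^sub>F k in sequentially. 0 \<le> \<alpha> k * expectation (\<lambda>\<omega>. norm (dbar k \<omega>))"
      using alpha_pos by (simp add: less_imp_le)
    show "\<forall>\<^sub>F k in sequentially. \<alpha> k * expectation (\<lambda>\<omega>. norm (dbar k \<omega>))
        \<le> \<eta> * \<rho> * expectation (\<lambda>\<omega>. norm (dbar k \<omega>))"
      using alpha_le by (intro always_eventually allI mult_right_mono) auto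
  qed
  show ?thesis
    using step2_int conv dbar_int mean_lim residual_int residual_lim by auto
qed

end
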